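(* Let $0<\alpha<\beta$. For $\hat d>0$ and $\sigma_e>0$ let $d=\hat d+e$ with $e\sim N(0,\sigma_e^2)$, and let $$C(\hat d)=C(\hat d,\sigma_e)=\min_{g\ge 0}\Big\{\alpha g+\beta\,\mathbb{E}\big[(d-g)^+\,\big|\,d>0\big]\Big\}-\alpha\,\mathbb{E}\big[d^+\,\big|\,d>0\big]$$ be the integration cost of the single-bus network, given that the net demand is positive. Then, in the small-$\sigma$ regime $\hat d/\sigma_e\to\infty$, the integration cost is linear in $\sigma_e$ with slope $p$, i.e. $$\lim_{\hat d/\sigma_e\to\infty}\frac{C(\hat d,\sigma_e)}{\sigma_e}=p,\qquad p=\beta\,\phi\!\left(Q^{-1}\!\left(\frac{\alpha}{\beta}\right)\right).$$
   Context: Notation: $(x)^+=\max(x,0)$; $\phi$ is the standard Gaussian density; $Q(x)=\int_x^\infty\phi(t)\,dt$ is the complementary standard Gaussian cumulative distribution function and $Q^{-1}:(0,1)\to\mathbb{R}$ its inverse. Single-bus two-stage dispatch: $\hat d$ is a (deterministic, known) day-ahead forecast of the net demand $d$, and $e=d-\hat d$ is the Gaussian forecast error. In the day-ahead stage an amount $g\ge 0$ of energy is bought at unit price $\alpha$; after $d$ is revealed the shortfall $(d-g)^+$ is bought at unit price $\beta$ (excess is disposed of for free). The integration cost is the optimal expected two-stage cost minus the expected cost of a clairvoyant who knows $d$ in advance and buys $d^+$ at price $\alpha$. The coefficient $p$ is called the price of uncertainty. The limit $\hat d/\sigma_e\to\infty$ means: for every $\varepsilon>0$ there is $M$ such that $|C(\hat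 d,\sigma_e)/\sigma_e-p|<\varepsilon$ whenever $\hat d>0$, $\sigma_e>0$ and $\hat d/\sigma_e>M$. *)

theory Defs
  imports "HOL-Probability.Probability"
begin

definition gauss_Q :: "real \<Rightarrow> real" where
  "gauss_Q x = (LINT t:{x..}|lborel. std_normal_density t)"

text \<open>\<^const>\<open>gauss_Q\<close> is a bijection from the reals onto the open interval from 0 to 1;
  the value of the next function outside that interval is arbitrary.\<close>

definition gauss_Q_inv :: "real \<Rightarrow> real" where
  "gauss_Q_inv = inv gauss_Q"

text \<open>Expectation conditional on an event \<open>A\<close> of positive probability:
  \<^term>\<open>uniform_measure M A\<close> is the conditional probability measure \<open>B \<mapsto> M (A \<inter> B) / M A\<close>.\<close>

definition expectation_given :: "'a measure \<Rightarrow> 'a set \<Rightarrow> ('a \<Rightarrow> real) \<Rightarrow> real" where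
  "expectation_given M A X = (\<integral>\<omega>. X \<omega> \<partial>uniform_measure M A)"

definition two_stage_cost ::
  "'a measure \<Rightarrow> real \<Rightarrow> real \<Rightarrow> ('a \<Rightarrow> real) \<Rightarrow> real \<Rightarrow> real" where
  "two_stage_cost M \<alpha> \<beta> d g =
     \<alpha> * g + \<beta> * expectation_given M {\<omega> \<in> space M. d \<omega> > 0} (\<lambda>\<omega>. max (d \<omega> - g) 0)"

definition clairvoyant_cost :: "'a measure \<Rightarrow> real \<Rightarrow> ('a \<Rightarrow> real) \<Rightarrow> real" where
  "clairvoyant_cost M \<alpha> d =
     \<alpha> * expectation_given M {\<omega> \<in> space M. d \<omega> > 0} (\<lambda>\<omega>. max (d \<omega>) 0)"

text \<open>The infimum stands for the minimum; that it is attained has to be shown separately.\<close>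

definition integration_cost :: "'a measure \<Rightarrow> real \<Rightarrow> real \<Rightarrow> ('a \<Rightarrow> real) \<Rightarrow> real" where
  "integration_cost M \<alpha> \<beta> d =
     (INF g\<in>{0..}. two_stage_cost M \<alpha> \<beta> d g) - clairvoyant_cost M \<alpha> d"

definition price_of_uncertainty :: "real \<Rightarrow> real \<Rightarrow> real" where
  "price_of_uncertainty \<alpha> \<beta> = \<beta> * std_normal_density (gauss_Q_inv (\<alpha> / \<beta>))"

end

theory Submission
  imports Defs "HOL-Real_Asymp.Real_Asymp"
begin

text \<open>
  The dispatch problem is a newsvendor problem, and measuring everything in units of \<open>\<sigma>\<close> makes it
  explicitly solvable. Put \<open>Z = e / \<sigma>\<close>, \<open>a = dhat / \<sigma>\<close>, \<open>g = dhat + \<sigma> t\<close> and \<open>P = Q (- a)\<close>, the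
  probability that the demand is positive. Since \<open>g \<ge> 0\<close>, a shortfall can only occur when the demand
  is positive, so conditioning on that event merely divides the unconditional expected shortfall by
  \<open>P\<close> (\<open>expected_shortfall_given_positive\<close>). With the normal loss
  \<open>L t = E (Z - t)\<^sup>+ = \<phi> t - t Q t\<close> the cost of \<open>g\<close> is therefore
  \<open>\<alpha> dhat + \<sigma> (\<alpha> t + \<beta> L t / P)\<close>.

  The function \<open>L\<close> is convex with slope \<open>- Q s\<close> at \<open>s\<close>. Its tangent at \<open>s\<close> takes the value
  \<open>\<phi> s - t Q s\<close> at \<open>t\<close>, and \<open>normal_loss_above_tangent\<close> obtains the convexity bound without
  differentiating \<open>L\<close>. Choosing \<open>s\<close> with \<open>Q s = \<alpha> P / \<beta>\<close> cancels the terms linear in \<open>t\<close>: every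
  purchase costs at least \<open>\<alpha> dhat + \<sigma> \<beta> \<phi> s / P\<close>, with equality at \<open>t = s\<close>. This purchase is
  admissible, because \<open>\<alpha> < \<beta>\<close> gives \<open>Q s < P = Q (- a)\<close> and hence \<open>s > - a\<close>, that is, \<open>g > 0\<close>.

  The clairvoyant cost is \<open>\<alpha>\<close> times the shortfall at \<open>g = 0\<close>, namely
  \<open>\<alpha> dhat + \<alpha> \<sigma> \<phi> a / P\<close>. The terms \<open>\<alpha> dhat\<close> cancel, which leaves
  \<open>C / \<sigma> = (\<beta> \<phi> (Q\<inverse> (\<alpha> P / \<beta>)) - \<alpha> \<phi> a) / P\<close> (\<open>integration_cost_eq\<close>). This depends on \<open>dhat\<close>
  and \<open>\<sigma>\<close> only through \<open>a\<close>; as \<open>a \<rightarrow> \<infinity>\<close> we have \<open>P \<rightarrow> 1\<close> and \<open>\<phi> a \<rightarrow> 0\<close>, and continuity of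
  \<open>Q\<inverse>\<close> at \<open>\<alpha> / \<beta>\<close> yields the limit.
\<close>

section \<open>The Gaussian tail function and its inverse\<close>

lemma gauss_Q_eq_measure: "gauss_Q x = measure std_normal_distribution {x..}"
proof -
  have "measure std_normal_distribution {x..} = (\<integral>z. indicator {x..} z \<partial>std_normal_distribution)"
    by simp
  also have "\<dots> = (\<integral>z. std_normal_density z *\<^sub>R indicator {x..} z \<partial>lborel)"
    by (rule integral_density) auto
  finally show ?thesis
    by (simp add: gauss_Q_def set_lebesgue_integral_def mult.commute)
qed

lemma std_normal_singleton: "measure std_normal_distribution {x} = 0"
proof -
  have "AE z in lborel. z \<in> {x} \<longrightarrow> ennreal (std_normal_density z) = 0"
    using AE_lborel_singleton[of x] by eventually_elim simp
  then have "{x} \<in> null_sets std_normal_distribution"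
    by (subst null_sets_density_iff) auto
  then show ?thesis
    by (rule measure_eq_0_null_sets)
qed

text \<open>Through this identity \<open>Q\<close> inherits its continuity and its limits from the general theory of
  distribution functions; it holds because the Gaussian has no atoms.\<close>

lemma gauss_Q_eq_cdf: "gauss_Q x = 1 - cdf std_normal_distribution x"
proof -
  interpret N: real_distribution std_normal_distribution
    by (rule real_dist_normal_dist)
  have "gauss_Q x = measure std_normal_distribution ({x} \<union> {x<..})"
    unfolding gauss_Q_eq_measure by (rule arg_cong[where f = "measure _"]) auto
  also have "\<dots> = measure std_normal_distribution {x<..}"
    by (subst N.finite_measure_Union) (auto simp: std_normal_singleton)
  also have "{x<..} = space std_normal_distribution - {..x}"
    by auto
  also have "measure std_normal_distribution \<dots> = 1 - cdf std_normal_distribution x"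
    unfolding cdf_def by (rule N.prob_compl) auto
  finally show ?thesis .
qed

lemma isCont_gauss_Q: "isCont gauss_Q x"
proof -
  interpret N: real_distribution std_normal_distribution
    by (rule real_dist_normal_dist)
  have "isCont (cdf std_normal_distribution) x"
    using std_normal_singleton by (simp add: N.isCont_cdf)
  then show ?thesis
    unfolding gauss_Q_eq_cdf[abs_def] by (intro continuous_intros)
qed

lemma gauss_Q_at_top: "(gauss_Q \<longlongrightarrow> 0) at_top"
proof -
  interpret N: real_distribution std_normal_distribution
    by (rule real_dist_normal_dist)
  show ?thesis
    unfolding gauss_Q_eq_cdf[abs_def] using tendsto_diff[OF tendsto_const[of 1] N.cdf_lim_at_top_prob]
    by simp
qed

lemma gauss_Q_at_bot: "(gauss_Q \<longlongrightarrow> 1) at_bot"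
proof -
  interpret N: real_distribution std_normal_distribution
    by (rule real_dist_normal_dist)
  show ?thesis
    unfolding gauss_Q_eq_cdf[abs_def] using tendsto_diff[OF tendsto_const[of 1] N.cdf_lim_at_bot]
    by simp
qed

text \<open>The density is nowhere zero, so an interval that the Gaussian does not charge would be a
  Lebesgue null set.\<close>

lemma gauss_Q_strict_antimono:
  assumes "s < t"
  shows "gauss_Q t < gauss_Q s"
proof -
  interpret N: real_distribution std_normal_distribution
    by (rule real_dist_normal_dist)
  have "{s..<t} \<notin> null_sets std_normal_distribution"
  proof
    assume "{s..<t} \<in> null_sets std_normal_distribution"
    then have "AE z in lborel. z \<notin> {s..<t}"
      using normal_density_pos[of 1 0]
      by (subst (asm) null_sets_density_iff) (auto elim!: eventually_mono simp: less_le)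
    then have "{s..<t} \<in> null_sets lborel"
      by (subst AE_iff_null_sets) auto
    then show False
      using assms by (auto simp: null_sets_def)
  qed
  then have "measure std_normal_distribution {s..<t} > 0"
    by (auto simp: null_sets_def N.emeasure_eq_measure zero_less_measure_iff)
  moreover have "gauss_Q s = measure std_normal_distribution ({s..<t} \<union> {t..})"
    unfolding gauss_Q_eq_measure using assms by (intro arg_cong[where f = "measure _"]) auto
  then have "gauss_Q s = measure std_normal_distribution {s..<t} + gauss_Q t"
    unfolding gauss_Q_eq_measure by (subst (asm) N.finite_measure_Union) auto
  ultimately show ?thesis
    by simp
qed

lemma gauss_Q_pos: "0 < gauss_Q x"
proof -
  have "0 \<le> gauss_Q (x + 1)"
    by (simp add: gauss_Q_eq_measure)
  also have "\<dots> < gauss_Q x"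
    by (rule gauss_Q_strict_antimono) simp
  finally show ?thesis .
qed

lemma gauss_Q_less_1: "gauss_Q x < 1"
proof -
  interpret N: real_distribution std_normal_distribution
    by (rule real_dist_normal_dist)
  have "gauss_Q x < gauss_Q (x - 1)"
    by (rule gauss_Q_strict_antimono) simp
  also have "\<dots> \<le> 1"
    by (simp add: gauss_Q_eq_measure)
  finally show ?thesis .
qed

lemma gauss_Q_inv_gauss_Q: "gauss_Q_inv (gauss_Q x) = x"
proof -
  have "inj gauss_Q"
    by (metis gauss_Q_strict_antimono injI less_irrefl linorder_neqE)
  then show ?thesis
    by (simp add: gauss_Q_inv_def)
qed

lemma gauss_Q_gauss_Q_inv:
  assumes "0 < y" "y < 1"
  shows "gauss_Q (gauss_Q_inv y) = y"
proof -
  obtain b where b: "gauss_Q b < y"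
    using order_tendstoD(2)[OF gauss_Q_at_top assms(1)] eventually_happens' trivial_limit_at_top_linorder
    by blast
  obtain a where a: "y < gauss_Q a"
    using order_tendstoD(1)[OF gauss_Q_at_bot assms(2)] eventually_happens' trivial_limit_at_bot_linorder
    by blast
  have "a \<le> b"
    using a b gauss_Q_strict_antimono[of b a] by linarith
  then obtain x where "gauss_Q x = y"
    using IVT2[of gauss_Q b y a] a b isCont_gauss_Q by fastforce
  then show ?thesis
    using gauss_Q_inv_gauss_Q by auto
qed

lemma isCont_gauss_Q_inv:
  assumes "0 < y" "y < 1"
  shows "isCont gauss_Q_inv y"
proof -
  have "isCont gauss_Q_inv (gauss_Q (gauss_Q_inv y))"
    by (rule isCont_inverse_function[of 1])
       (simp_all add: gauss_Q_inv_gauss_Q isCont_gauss_Q)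
  then show ?thesis
    by (simp add: gauss_Q_gauss_Q_inv assms)
qed

section \<open>The expected shortfall of a standard Gaussian demand\<close>

lemma isCont_std_normal_density: "isCont std_normal_density x"
  unfolding std_normal_density_def[abs_def] by (intro continuous_intros) simp

lemma std_normal_density_at_top: "(std_normal_density \<longlongrightarrow> 0) at_top"
  unfolding std_normal_density_def[abs_def] by real_asymp

text \<open>The integrand \<open>z \<phi> z\<close> has the antiderivative \<open>- \<phi>\<close>, which vanishes at infinity.\<close>

lemma gauss_tail_first_moment:
  "(\<integral>z. std_normal_density z * (z * indicator {s..} z) \<partial>lborel) = std_normal_density s"
proof -
  have int: "integrable lborel (\<lambda>z. std_normal_density z * z)"
    using integrable_std_normal_moment[of 1] by simp
  have "(LBINT z=ereal s..\<infinity>. std_normal_density z * z) = 0 - (- std_normal_density s)"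
  proof (rule interval_integral_FTC_integrable[where F = "\<lambda>z. - std_normal_density z"])
    fix x :: real
    have "((\<lambda>z. - (c * exp (- z\<^sup>2 / 2))) has_real_derivative c * exp (- x\<^sup>2 / 2) * x) (at x)" for c
      by (auto intro!: derivative_eq_intros)
    then show "((\<lambda>z. - std_normal_density z) has_vector_derivative std_normal_density x * x) (at x)"
      unfolding std_normal_density_def has_real_derivative_iff_has_vector_derivative[symmetric] .
    show "isCont (\<lambda>z. std_normal_density z * z) x"
      by (intro continuous_intros isCont_std_normal_density)
  next
    show "set_integrable lborel (einterval (ereal s) \<infinity>) (\<lambda>z. std_normal_density z * z)"
      using int unfolding set_integrable_def by (intro integrable_mult_indicator) auto
    show "(((\<lambda>z. - std_normal_density z) \<circ> real_of_ereal) \<longlongrightarrow> - std_normal_density s)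
            (at_right (ereal s))"
      unfolding ereal_tendsto_simps
      using isCont_std_normal_density[of s]
      by (intro tendsto_minus) (auto simp: isCont_def intro: filterlim_at_within_If tendsto_mono at_within_le_at)
    show "(((\<lambda>z. - std_normal_density z) \<circ> real_of_ereal) \<longlongrightarrow> 0) (at_left \<infinity>)"
      unfolding ereal_tendsto_simps using tendsto_minus[OF std_normal_density_at_top] by simp
  qed auto
  then have "std_normal_density s = (LINT z:{s<..}|lborel. std_normal_density z * z)"
    by (simp add: interval_integral_to_infinity_eq)
  also have "\<dots> = (\<integral>z. std_normal_density z * (z * indicator {s..} z) \<partial>lborel)"
    unfolding set_lebesgue_integral_def
  proof (rule integral_cong_AE)
    show "AE z in lborel. indicator {s<..} z *\<^sub>R (std_normal_density z * z)
            = std_normal_density z * (z * indicator {s..} z)"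
      using AE_lborel_singleton[of s] by eventually_elim (auto simp: indicator_def)
  qed auto
  finally show ?thesis ..
qed

text \<open>The mean of \<open>(Z - t) 1{Z \<ge> s}\<close>. Keeping \<open>s\<close> and \<open>t\<close> apart serves two purposes: \<open>s = t\<close> gives
  the expected shortfall, and other values of \<open>s\<close> give its tangents.\<close>

lemma gauss_tail_affine_moment:
  shows "integrable lborel (\<lambda>z. std_normal_density z * ((z - t) * indicator {s..} z))" (is ?int)
    and "(\<integral>z. std_normal_density z * ((z - t) * indicator {s..} z) \<partial>lborel)
           = std_normal_density s - t * gauss_Q s" (is ?eq)
proof -
  have int: "integrable lborel (\<lambda>z. std_normal_density z * z)"
    using integrable_std_normal_moment[of 1] by simp
  have 1: "integrable lborel (\<lambda>z. std_normal_density z * (z * indicator {s..} z))"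
    using integrable_mult_indicator[OF _ int, of "{s..}"] by (simp add: mult_ac)
  have 2: "integrable lborel (\<lambda>z. t * (indicator {s..} z * std_normal_density z))"
    using integrable_mult_indicator[of "{s..}" lborel std_normal_density]
    by (intro integrable_mult_right) simp
  have split: "std_normal_density z * ((z - t) * indicator {s..} z)
      = std_normal_density z * (z * indicator {s..} z) - t * (indicator {s..} z * std_normal_density z)" for z
    by (simp add: algebra_simps)
  show ?int
    unfolding split using 1 2 by (rule Bochner_Integration.integrable_diff)
  show ?eq
    unfolding split Bochner_Integration.integral_diff[OF 1 2] gauss_tail_first_moment
    by (simp add: gauss_Q_def set_lebesgue_integral_def)
qed

definition normal_loss :: "real \<Rightarrow> real" where
  "normal_loss t = std_normal_density t - t * gauss_Q t"

lemma normal_loss_eq_integral: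
  shows "integrable lborel (\<lambda>z. std_normal_density z * max (z - t) 0)"
    and "(\<integral>z. std_normal_density z * max (z - t) 0 \<partial>lborel) = normal_loss t"
proof -
  have "max (z - t) 0 = (z - t) * indicator {t..} z" for z :: real
    by (auto simp: indicator_def)
  then show "integrable lborel (\<lambda>z. std_normal_density z * max (z - t) 0)"
    and "(\<integral>z. std_normal_density z * max (z - t) 0 \<partial>lborel) = normal_loss t"
    by (simp_all add: gauss_tail_affine_moment normal_loss_def)
qed

text \<open>The left-hand side, as a function of \<open>t\<close>, is the tangent of the loss at \<open>s\<close>. It is the mean of
  \<open>(Z - t) 1{Z \<ge> s}\<close>, and on either side of \<open>s\<close> this random variable is at most \<open>(Z - t)\<^sup>+\<close>.\<close>

lemma normal_loss_above_tangent: "std_normal_density s - t * gauss_Q s \<le> normal_loss t"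
proof -
  have "std_normal_density s - t * gauss_Q s
      = (\<integral>z. std_normal_density z * ((z - t) * indicator {s..} z) \<partial>lborel)"
    by (simp add: gauss_tail_affine_moment)
  also have "\<dots> \<le> (\<integral>z. std_normal_density z * max (z - t) 0 \<partial>lborel)"
    by (intro integral_mono gauss_tail_affine_moment normal_loss_eq_integral mult_left_mono)
       (auto simp: indicator_def)
  finally show ?thesis
    by (simp add: normal_loss_eq_integral)
qed

section \<open>Conditional costs in standardized form\<close>

lemma (in prob_space) expectation_given_eq:
  fixes X :: "'a \<Rightarrow> real"
  assumes [measurable]: "A \<in> events" "X \<in> borel_measurable M"
    and "prob A > 0"
  shows "expectation_given M A X = expectation (\<lambda>\<omega>. indicator A \<omega> * X \<omega>) / prob A"
proof -
  have "uniform_measure M A = density M (\<lambda>\<omega>. ennreal (indicator A \<omega> / prob A))"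
    unfolding uniform_measure_def emeasure_eq_measure using \<open>prob A > 0\<close>
    by (intro density_cong) (auto simp: indicator_def divide_ennreal ennreal_1[symmetric] simp del: ennreal_1)
  then have "expectation_given M A X = expectation (\<lambda>\<omega>. (indicator A \<omega> / prob A) *\<^sub>R X \<omega>)"
    unfolding expectation_given_def using integral_density[of X M "\<lambda>\<omega>. indicator A \<omega> / prob A"] by simp
  then show ?thesis
    by simp
qed

text \<open>For \<open>g \<ge> 0\<close> the shortfall vanishes outside the conditioning event, so the condition enters only
  through the normalizing factor.\<close>

lemma (in prob_space) expected_shortfall_given_positive:
  assumes "0 < \<sigma>" "0 \<le> g" and E: "distributed M lborel E (normal_density 0 \<sigma>)"
  shows "expectation_given M {\<omega> \<in> space M. m + E \<omega> > 0} (\<lambda>\<omega>. max (m + E \<omega> - g) 0)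
           = \<sigma> * normal_loss ((g - m) / \<sigma>) / gauss_Q (- m / \<sigma>)"
proof -
  let ?A = "{\<omega> \<in> space M. m + E \<omega> > 0}"
  have Z: "distributed M lborel (\<lambda>\<omega>. E \<omega> / \<sigma>) std_normal_density"
    using E normal_standard_normal_convert[OF \<open>0 < \<sigma>\<close>, of E 0] by simp
  have [measurable]: "E \<in> borel_measurable M"
    using distributed_measurable[OF E] by simp
  \<comment> \<open>The event is \<open>Z > - m / \<sigma>\<close> with strict inequality, whereas \<^const>\<open>gauss_Q\<close> integrates over a closed
      half-line; the boundary value has probability zero.\<close>
  have AE_ne: "AE \<omega> in M. E \<omega> / \<sigma> \<noteq> - m / \<sigma>"
  proof -
    have "AE z in lborel. 0 < ennreal (std_normal_density z) \<longrightarrow> z \<noteq> - m / \<sigma>"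
      using AE_lborel_singleton[of "- m / \<sigma>"] by eventually_elim auto
    then show ?thesis
      using distributed_AE2[OF Z, of "\<lambda>z. z \<noteq> - m / \<sigma>"] by simp
  qed
  have "prob ?A = expectation (indicator ?A)"
    by simp
  also have "\<dots> = expectation (\<lambda>\<omega>. indicator {- m / \<sigma>..} (E \<omega> / \<sigma>))"
  proof (rule integral_cong_AE)
    show "AE \<omega> in M. indicator ?A \<omega> = (indicator {- m / \<sigma>..} (E \<omega> / \<sigma>) :: real)"
      using AE_ne AE_space
      by eventually_elim (use \<open>0 < \<sigma>\<close> in \<open>auto simp: indicator_def field_simps\<close>)
  qed auto
  also have "\<dots> = (\<integral>z. std_normal_density z * indicator {- m / \<sigma>..} z \<partial>lborel)"
    by (rule distributed_integral[OF Z, symmetric]) auto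
  also have "\<dots> = gauss_Q (- m / \<sigma>)"
    by (simp add: gauss_Q_def set_lebesgue_integral_def mult.commute)
  finally have prob_A: "prob ?A = gauss_Q (- m / \<sigma>)" .
  have "expectation (\<lambda>\<omega>. indicator ?A \<omega> * max (m + E \<omega> - g) 0)
      = expectation (\<lambda>\<omega>. \<sigma> * max (E \<omega> / \<sigma> - (g - m) / \<sigma>) 0)"
  proof (rule Bochner_Integration.integral_cong)
    fix \<omega> assume "\<omega> \<in> space M"
    have "\<sigma> * max (E \<omega> / \<sigma> - (g - m) / \<sigma>) 0 = max (m + E \<omega> - g) 0"
      using \<open>0 < \<sigma>\<close> by (simp add: max_def field_simps)
    moreover have "indicator ?A \<omega> * max (m + E \<omega> - g) 0 = max (m + E \<omega> - g) 0"
      using \<open>0 \<le> g\<close> \<open>\<omega> \<in> space M\<close> by (auto simp: indicator_def)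
    ultimately show "indicator ?A \<omega> * max (m + E \<omega> - g) 0 = \<sigma> * max (E \<omega> / \<sigma> - (g - m) / \<sigma>) 0"
      by simp
  qed simp
  also have "\<dots> = \<sigma> * expectation (\<lambda>\<omega>. max (E \<omega> / \<sigma> - (g - m) / \<sigma>) 0)"
    by simp
  also have "expectation (\<lambda>\<omega>. max (E \<omega> / \<sigma> - (g - m) / \<sigma>) 0)
      = (\<integral>z. std_normal_density z * max (z - (g - m) / \<sigma>) 0 \<partial>lborel)"
    by (rule distributed_integral[OF Z, symmetric]) auto
  finally have "expectation (\<lambda>\<omega>. indicator ?A \<omega> * max (m + E \<omega> - g) 0)
      = \<sigma> * normal_loss ((g - m) / \<sigma>)"
    by (simp add: normal_loss_eq_integral)
  then show ?thesis
    by (subst expectation_given_eq) (auto simp: prob_A gauss_Q_pos)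
qed

section \<open>The optimal purchase and the integration cost\<close>

text \<open>The standardized optimal purchase: the solution \<open>s\<close> of the first-order condition
  \<open>\<alpha> = \<beta> P (Z > s | Z > - a)\<close>, at which the day-ahead price of a further unit equals the real-time
  price times the conditional probability that the unit is needed.\<close>

definition critical_fractile :: "real \<Rightarrow> real \<Rightarrow> real \<Rightarrow> real" where
  "critical_fractile \<alpha> \<beta> a = gauss_Q_inv (\<alpha> * gauss_Q (- a) / \<beta>)"

lemma gauss_Q_critical_fractile:
  assumes "0 < \<alpha>" "\<alpha> < \<beta>"
  shows "gauss_Q (critical_fractile \<alpha> \<beta> a) = \<alpha> * gauss_Q (- a) / \<beta>"
proof -
  have "\<alpha> * gauss_Q (- a) < \<beta> * 1"
    using assms gauss_Q_pos gauss_Q_less_1 by (intro mult_strict_mono) (auto intro: less_imp_le)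
  then show ?thesis
    unfolding critical_fractile_def using assms
    by (intro gauss_Q_gauss_Q_inv) (auto simp: gauss_Q_pos field_simps)
qed

text \<open>This makes the unconstrained optimum a nonnegative purchase: the condition \<open>\<alpha> < \<beta>\<close> keeps
  \<open>Q\<close> of the fractile below \<open>Q (- a)\<close>.\<close>

lemma critical_fractile_ge:
  assumes "0 < \<alpha>" "\<alpha> < \<beta>"
  shows "- a \<le> critical_fractile \<alpha> \<beta> a"
proof (rule ccontr)
  assume "\<not> - a \<le> critical_fractile \<alpha> \<beta> a"
  then have "gauss_Q (- a) < \<alpha> * gauss_Q (- a) / \<beta>"
    using gauss_Q_strict_antimono[of "critical_fractile \<alpha> \<beta> a" "- a"]
    by (simp add: gauss_Q_critical_fractile[OF assms])
  moreover have "\<alpha> * gauss_Q (- a) < \<beta> * gauss_Q (- a)"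
    using assms gauss_Q_pos by (intro mult_strict_right_mono)
  ultimately show False
    using assms by (simp add: field_simps)
qed

context prob_space
begin

lemma two_stage_cost_eq:
  assumes "0 < \<sigma>" "0 \<le> g" "distributed M lborel E (normal_density 0 \<sigma>)"
  shows "two_stage_cost M \<alpha> \<beta> (\<lambda>\<omega>. m + E \<omega>) g
           = \<alpha> * g + \<beta> * (\<sigma> * normal_loss ((g - m) / \<sigma>) / gauss_Q (- m / \<sigma>))"
  unfolding two_stage_cost_def by (simp only: expected_shortfall_given_positive[OF assms])

text \<open>At the fractile the tangent of \<open>\<beta> L / P\<close> has slope \<open>- \<beta> Q s / P = - \<alpha>\<close>, so
  replacing the loss by its tangent there turns the cost into a constant in \<open>g\<close>, and this constant is a lower bound.\<close>

lemma two_stage_cost_ge: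
  assumes "0 < \<alpha>" "\<alpha> < \<beta>" "0 < \<sigma>" "0 \<le> g" "distributed M lborel E (normal_density 0 \<sigma>)"
  shows "\<alpha> * m + \<sigma> * \<beta> * std_normal_density (critical_fractile \<alpha> \<beta> (m / \<sigma>)) / gauss_Q (- m / \<sigma>)
           \<le> two_stage_cost M \<alpha> \<beta> (\<lambda>\<omega>. m + E \<omega>) g"
proof -
  define P where "P = gauss_Q (- m / \<sigma>)"
  define s where "s = critical_fractile \<alpha> \<beta> (m / \<sigma>)"
  define t where "t = (g - m) / \<sigma>"
  have P: "0 < P"
    by (simp add: P_def gauss_Q_pos)
  have Qs: "gauss_Q s = \<alpha> * P / \<beta>"
    unfolding s_def P_def using gauss_Q_critical_fractile[OF assms(1,2)] by simp
  have g: "g = m + \<sigma> * t"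
    using \<open>0 < \<sigma>\<close> by (simp add: t_def)
  have "\<alpha> * m + \<sigma> * \<beta> * std_normal_density s / P
      = \<alpha> * g + \<sigma> * \<beta> / P * (std_normal_density s - t * gauss_Q s)"
    using P assms by (simp add: Qs g field_simps)
  also have "\<dots> \<le> \<alpha> * g + \<sigma> * \<beta> / P * normal_loss t"
    using P assms by (intro add_left_mono mult_left_mono normal_loss_above_tangent) auto
  also have "\<dots> = two_stage_cost M \<alpha> \<beta> (\<lambda>\<omega>. m + E \<omega>) g"
    unfolding two_stage_cost_eq[OF assms(3-5)] P_def t_def by simp
  finally show ?thesis
    by (simp add: s_def P_def)
qed

text \<open>At the point of tangency the bound is attained.\<close>

lemma two_stage_cost_optimum:
  fixes m \<sigma> :: real
  assumes "0 < \<alpha>" "\<alpha> < \<beta>" "0 < \<sigma>" "distributed M lborel E (normal_density 0 \<sigma>)"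
  defines "g \<equiv> m + \<sigma> * critical_fractile \<alpha> \<beta> (m / \<sigma>)"
  shows "0 \<le> g"
    and "two_stage_cost M \<alpha> \<beta> (\<lambda>\<omega>. m + E \<omega>) g
      = \<alpha> * m + \<sigma> * \<beta> * std_normal_density (critical_fractile \<alpha> \<beta> (m / \<sigma>)) / gauss_Q (- m / \<sigma>)"
proof -
  define P where "P = gauss_Q (- m / \<sigma>)"
  define s where "s = critical_fractile \<alpha> \<beta> (m / \<sigma>)"
  have P: "0 < P"
    by (simp add: P_def gauss_Q_pos)
  have Qs: "gauss_Q s = \<alpha> * P / \<beta>"
    unfolding s_def P_def using gauss_Q_critical_fractile[OF assms(1,2)] by simp
  show "0 \<le> g"
    using critical_fractile_ge[OF assms(1,2), of "m / \<sigma>"] \<open>0 < \<sigma>\<close>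
    by (simp add: g_def field_simps)
  have "(g - m) / \<sigma> = s"
    using \<open>0 < \<sigma>\<close> by (simp add: g_def s_def)
  then have "two_stage_cost M \<alpha> \<beta> (\<lambda>\<omega>. m + E \<omega>) g
      = \<alpha> * (m + \<sigma> * s) + \<beta> * (\<sigma> * (std_normal_density s - s * gauss_Q s) / P)"
    unfolding two_stage_cost_eq[OF \<open>0 < \<sigma>\<close> \<open>0 \<le> g\<close> assms(4)]
    by (simp add: normal_loss_def P_def) (simp add: g_def s_def)
  also have "\<dots> = \<alpha> * m + \<sigma> * \<beta> * std_normal_density s / P"
    using P assms by (simp add: Qs field_simps)
  finally show "two_stage_cost M \<alpha> \<beta> (\<lambda>\<omega>. m + E \<omega>) g
      = \<alpha> * m + \<sigma> * \<beta> * std_normal_density (critical_fractile \<alpha> \<beta> (m / \<sigma>)) / gauss_Q (- m / \<sigma>)"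
    by (simp add: s_def P_def)
qed

text \<open>The clairvoyant pays for the shortfall that a purchase of \<open>g = 0\<close> would leave.\<close>

lemma clairvoyant_cost_eq:
  assumes "0 < \<sigma>" "distributed M lborel E (normal_density 0 \<sigma>)"
  shows "clairvoyant_cost M \<alpha> (\<lambda>\<omega>. m + E \<omega>)
           = \<alpha> * m + \<alpha> * \<sigma> * std_normal_density (m / \<sigma>) / gauss_Q (- m / \<sigma>)"
proof -
  have sym: "std_normal_density (- (m / \<sigma>)) = std_normal_density (m / \<sigma>)"
    by (simp add: std_normal_density_def)
  have "clairvoyant_cost M \<alpha> (\<lambda>\<omega>. m + E \<omega>)
      = \<alpha> * (\<sigma> * normal_loss (- m / \<sigma>) / gauss_Q (- m / \<sigma>))"
    unfolding clairvoyant_cost_def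
    using expected_shortfall_given_positive[OF assms(1) order_refl assms(2), of m] by simp
  also have "\<dots> = \<alpha> * m + \<alpha> * \<sigma> * std_normal_density (m / \<sigma>) / gauss_Q (- m / \<sigma>)"
    using gauss_Q_pos[of "- (m / \<sigma>)"] assms(1) by (simp add: normal_loss_def sym field_simps)
  finally show ?thesis .
qed

lemma integration_cost_eq:
  assumes "0 < \<alpha>" "\<alpha> < \<beta>" "0 < \<sigma>" "distributed M lborel E (normal_density 0 \<sigma>)"
  shows "integration_cost M \<alpha> \<beta> (\<lambda>\<omega>. m + E \<omega>) / \<sigma>
           = (\<beta> * std_normal_density (critical_fractile \<alpha> \<beta> (m / \<sigma>)) - \<alpha> * std_normal_density (m / \<sigma>))
               / gauss_Q (- (m / \<sigma>))"
proof -
  let ?v = "\<alpha> * m + \<sigma> * \<beta> * std_normal_density (critical_fractile \<alpha> \<beta> (m / \<sigma>)) / gauss_Q (- m / \<sigma>)"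
  have "(INF g\<in>{0..}. two_stage_cost M \<alpha> \<beta> (\<lambda>\<omega>. m + E \<omega>) g) = ?v"
    using two_stage_cost_optimum[OF assms, of m] two_stage_cost_ge[OF assms(1-3) _ assms(4), of _ m]
    by (intro cInf_eq_minimum) (force simp del: times_divide_eq_right)+
  then show ?thesis
    unfolding integration_cost_def clairvoyant_cost_eq[OF assms(3,4)]
    using assms(3) by (simp add: diff_divide_distrib)
qed

end

lemma normalized_cost_tendsto_price:
  assumes "0 < \<alpha>" "\<alpha> < \<beta>"
  shows "((\<lambda>a. (\<beta> * std_normal_density (critical_fractile \<alpha> \<beta> a) - \<alpha> * std_normal_density a)
             / gauss_Q (- a)) \<longlongrightarrow> price_of_uncertainty \<alpha> \<beta>) at_top"
proof -
  have P: "((\<lambda>a. gauss_Q (- a)) \<longlongrightarrow> 1) at_top"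
    by (rule filterlim_compose[OF gauss_Q_at_bot filterlim_uminus_at_bot_at_top])
  have "((\<lambda>a. \<alpha> * gauss_Q (- a) / \<beta>) \<longlongrightarrow> \<alpha> * 1 / \<beta>) at_top"
    using assms by (intro tendsto_intros P) auto
  moreover have "isCont gauss_Q_inv (\<alpha> / \<beta>)"
    using assms by (intro isCont_gauss_Q_inv) auto
  ultimately have "((\<lambda>a. critical_fractile \<alpha> \<beta> a) \<longlongrightarrow> gauss_Q_inv (\<alpha> / \<beta>)) at_top"
    unfolding critical_fractile_def by (intro isCont_tendsto_compose[of _ gauss_Q_inv]) auto
  then have "((\<lambda>a. std_normal_density (critical_fractile \<alpha> \<beta> a))
      \<longlongrightarrow> std_normal_density (gauss_Q_inv (\<alpha> / \<beta>))) at_top"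
    by (rule isCont_tendsto_compose[OF isCont_std_normal_density])
  then have "((\<lambda>a. (\<beta> * std_normal_density (critical_fractile \<alpha> \<beta> a) - \<alpha> * std_normal_density a)
             / gauss_Q (- a)) \<longlongrightarrow>
             (\<beta> * std_normal_density (gauss_Q_inv (\<alpha> / \<beta>)) - \<alpha> * 0) / 1) at_top"
    by (intro tendsto_intros P std_normal_density_at_top) auto
  then show ?thesis
    by (simp add: price_of_uncertainty_def)
qed

theorem theorem1:
  fixes \<alpha> \<beta> :: real
    and M :: "'a measure"
    and e :: "real \<Rightarrow> 'a \<Rightarrow> real"
  assumes "0 < \<alpha>" and "\<alpha> < \<beta>"
    and "prob_space M"
    and "\<And>\<sigma>. 0 < \<sigma> \<Longrightarrow> distributed M lborel (e \<sigma>) (normal_density 0 \<sigma>)"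
  shows "(\<forall>dhat>0. \<forall>\<sigma>>0. \<exists>g\<ge>0. \<forall>g'\<ge>0.
            two_stage_cost M \<alpha> \<beta> (\<lambda>\<omega>. dhat + e \<sigma> \<omega>) g
              \<le> two_stage_cost M \<alpha> \<beta> (\<lambda>\<omega>. dhat + e \<sigma> \<omega>) g')
       \<and> (\<forall>\<epsilon>>0. \<exists>R. \<forall>dhat>0. \<forall>\<sigma>>0. dhat / \<sigma> > R \<longrightarrow>
            \<bar>integration_cost M \<alpha> \<beta> (\<lambda>\<omega>. dhat + e \<sigma> \<omega>) / \<sigma>
              - price_of_uncertainty \<alpha> \<beta>\<bar> < \<epsilon>)"
proof (intro conjI allI impI)
  interpret prob_space M
    by fact
  fix dhat \<sigma> :: real
  assume "0 < dhat" "0 < \<sigma>"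
  note opt = two_stage_cost_optimum[OF assms(1,2) \<open>0 < \<sigma>\<close> assms(4)[OF \<open>0 < \<sigma>\<close>], of dhat]
  show "\<exists>g\<ge>0. \<forall>g'\<ge>0. two_stage_cost M \<alpha> \<beta> (\<lambda>\<omega>. dhat + e \<sigma> \<omega>) g
          \<le> two_stage_cost M \<alpha> \<beta> (\<lambda>\<omega>. dhat + e \<sigma> \<omega>) g'"
  proof (intro exI conjI allI impI)
    show "0 \<le> dhat + \<sigma> * critical_fractile \<alpha> \<beta> (dhat / \<sigma>)"
      by (rule opt(1))
    fix g' :: real
    assume "0 \<le> g'"
    then show "two_stage_cost M \<alpha> \<beta> (\<lambda>\<omega>. dhat + e \<sigma> \<omega>)
          (dhat + \<sigma> * critical_fractile \<alpha> \<beta> (dhat / \<sigma>))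
        \<le> two_stage_cost M \<alpha> \<beta> (\<lambda>\<omega>. dhat + e \<sigma> \<omega>) g'"
      unfolding opt(2)
      by (rule two_stage_cost_ge[OF assms(1,2) \<open>0 < \<sigma>\<close> _ assms(4)[OF \<open>0 < \<sigma>\<close>]])
  qed
next
  interpret prob_space M
    by fact
  fix \<epsilon> :: real
  assume "0 < \<epsilon>"
  then obtain R where R: "\<And>a. R \<le> a \<Longrightarrow>
      \<bar>(\<beta> * std_normal_density (critical_fractile \<alpha> \<beta> a) - \<alpha> * std_normal_density a) / gauss_Q (- a)
        - price_of_uncertainty \<alpha> \<beta>\<bar> < \<epsilon>"
    using tendstoD[OF normalized_cost_tendsto_price[OF assms(1,2)] \<open>0 < \<epsilon>\<close>]
    unfolding eventually_at_top_linorder dist_real_def by blast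
  show "\<exists>R. \<forall>dhat>0. \<forall>\<sigma>>0. dhat / \<sigma> > R \<longrightarrow>
          \<bar>integration_cost M \<alpha> \<beta> (\<lambda>\<omega>. dhat + e \<sigma> \<omega>) / \<sigma> - price_of_uncertainty \<alpha> \<beta>\<bar> < \<epsilon>"
    using R integration_cost_eq[OF assms(1,2) _ assms(4)]
    by (intro exI[of _ R]) (auto intro: less_imp_le)
qed

end
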